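(* Let $\boldsymbol{\Upsilon}_{\mathbf{G}}:\mathbf{G}\to\mathbf{WSym}$ be the linear map sending a graph $G$ with vertex set $[n]$ to its chromatic symmetric function in non-commuting variables, $\boldsymbol{\Upsilon}_{\mathbf{G}}(G)=\sum_f \mathbf{a}_{f(1)}\cdots\mathbf{a}_{f(n)}$, the sum running over proper colorings $f$ of $G$. Then the linear subspace $\ker\boldsymbol{\Upsilon}_{\mathbf{G}}$ of $\mathbf{G}$ is spanned by the modular relations on graphs, and the image of $\boldsymbol{\Upsilon}_{\mathbf{G}}$ is $\mathbf{WSym}$.
   Context: $\mathbb{K}$ is a field of characteristic zero; $\mathbb{N}=\{1,2,\dots\}$ and $[n]=\{1,\dots,n\}$. $\mathbf{G}=\bigoplus_{n\ge 0}\mathbf{G}_n$, where $\mathbf{G}_n$ is the $\mathbb{K}$-vector space freely generated by the (simple) graphs with vertex set $[n]$. A coloring of $G$ is a function $f:V(G)\to\mathbb{N}$; it is proper if no edge is monochromatic. $\{\mathbf{a}_i\}_{i\ge 1}$ are non-commuting variables. For a set partition $\boldsymbol{\pi}$ of $[n]$ let $\mathbf{m}_{\boldsymbol{\pi}}=\sum_f \mathbf{a}_{f(1)}\cdots\mathbf{a}_{f(n)}$, the sum running over all $f:[n]\to\mathbb{N}$ such that $f(i)=f(j)$ if and only if $i,j$ lie in the same block of $\boldsymbol{\pi}$. $\mathbf{WSym}=\bigoplus_{n\ge 0}\mathbf{WSym}_n$, where $\mathbf{WSym}_n$ is the $\mathbb{K}$-span of $\{\mathbf{m}_{\boldsymbol{\pi}}\}$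 over set partitions $\boldsymbol{\pi}$ of $[n]$. Modular relation on graphs: let $G$ be a graph with vertex set $[n]$ and $e_1,e_2,e_3$ the three edges of a triangle on three distinct vertices of $[n]$ with $e_3\in E(G)$ and $e_1,e_2\notin E(G)$. The corresponding modular relation is the element $G-G\cup\{e_1\}-G\cup\{e_2\}+G\cup\{e_1,e_2\}$ of $\mathbf{G}$, where $G\cup E$ denotes $G$ with the edges in $E$ added. *)

theory Defs
  imports Complex_Main "HOL-Library.Poly_Mapping" "HOL-Library.Disjoint_Sets"
    "HOL-Library.FuncSet" "HOL-Library.Function_Algebras"
begin

text \<open>A graph with vertex set \<open>{1..n}\<close> is a pair \<open>(n, E)\<close>. Keeping \<open>n\<close> in the pair makes the
  graphs with different vertex sets distinct basis vectors.\<close>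

type_synonym graph = "nat \<times> nat set set"

definition all_edges :: "nat \<Rightarrow> nat set set" where
  "all_edges n = {{i, j} | i j. i \<in> {1..n} \<and> j \<in> {1..n} \<and> i \<noteq> j}"

definition graphs :: "graph set" where
  "graphs = {(n, E). E \<subseteq> all_edges n}"

definition proper_coloring :: "graph \<Rightarrow> (nat \<Rightarrow> nat) \<Rightarrow> bool" where
  "proper_coloring G f \<longleftrightarrow> (\<forall>i j. {i, j} \<in> snd G \<longrightarrow> f i \<noteq> f j)"

definition graph_space :: "(graph \<Rightarrow>\<^sub>0 'k::field_char_0) set" where
  "graph_space = {x. Poly_Mapping.keys x \<subseteq> graphs}"

definition graph_scale :: "'k::field_char_0 \<Rightarrow> (graph \<Rightarrow>\<^sub>0 'k) \<Rightarrow> (graph \<Rightarrow>\<^sub>0 'k)" where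
  "graph_scale c x = Poly_Mapping.map (\<lambda>a. c * a) x"

abbreviation basis :: "graph \<Rightarrow> (graph \<Rightarrow>\<^sub>0 'k::field_char_0)" where
  "basis G \<equiv> Poly_Mapping.single G 1"

text \<open>A formal series in the non-commuting variables \<open>a\<^sub>1, a\<^sub>2, \<dots>\<close> is its coefficient function on
  words, the word \<open>[i\<^sub>1, \<dots>, i\<^sub>n]\<close> standing for the monomial \<open>a\<^bsub>i\<^sub>1\<^esub> \<cdots> a\<^bsub>i\<^sub>n\<^esub>\<close>.\<close>

type_synonym 'k series = "nat list \<Rightarrow> 'k"

definition series_scale :: "'k::field_char_0 \<Rightarrow> 'k series \<Rightarrow> 'k series" where
  "series_scale c F = (\<lambda>w. c * F w)"

text \<open>The formal sum of the monomials \<open>a\<^bsub>f 1\<^esub> \<cdots> a\<^bsub>f n\<^esub>\<close> over all functions \<open>f\<close> from \<open>{1..n}\<close> to the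
  positive integers such that \<open>P f\<close>: the coefficient of a word is the number of those \<open>f\<close>
  that spell it. Functions are taken extensional, so that each is counted once; there is at
  most one for each word.\<close>

definition monomial_sum :: "nat \<Rightarrow> ((nat \<Rightarrow> nat) \<Rightarrow> bool) \<Rightarrow> 'k::field_char_0 series" where
  "monomial_sum n P =
     (\<lambda>w. of_nat (card {f \<in> {1..n} \<rightarrow>\<^sub>E {1..}. P f \<and> map f [1..<Suc n] = w}))"

definition m_series :: "nat \<Rightarrow> nat set set \<Rightarrow> 'k::field_char_0 series" where
  "m_series n \<pi> = monomial_sum n
     (\<lambda>f. \<forall>i\<in>{1..n}. \<forall>j\<in>{1..n}. f i = f j \<longleftrightarrow> (\<exists>B\<in>\<pi>. i \<in> B \<and> j \<in> B))"

definition chromatic_series :: "graph \<Rightarrow> 'k::field_char_0 series" where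
  "chromatic_series G = monomial_sum (fst G) (proper_coloring G)"

lemma lookup_graph_scale: "Poly_Mapping.lookup (graph_scale c x) G = c * Poly_Mapping.lookup x G"
  by (simp add: graph_scale_def Poly_Mapping.map.rep_eq when_def)

interpretation graph_vs: vector_space "graph_scale :: 'k::field_char_0 \<Rightarrow> _"
  by unfold_locales
    (rule poly_mapping_eqI, simp add: lookup_graph_scale lookup_add algebra_simps)+

interpretation series_vs: vector_space "series_scale :: 'k::field_char_0 \<Rightarrow> _"
  by unfold_locales (auto simp: series_scale_def fun_eq_iff algebra_simps)

definition WSym_degree :: "nat \<Rightarrow> 'k::field_char_0 series set" where
  "WSym_degree n = series_vs.span {m_series n \<pi> | \<pi>. partition_on {1..n} \<pi>}"

lemma WSym_degree_support:
  fixes F :: "'k::field_char_0 series"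
  assumes "F \<in> WSym_degree n" "length w \<noteq> n"
  shows "F w = 0"
  using assms(1) unfolding WSym_degree_def
proof (induction rule: series_vs.span_induct_alt)
  case base
  then show ?case by simp
next
  case (step c x y)
  then obtain \<pi> where "x = m_series n \<pi>"
    by blast
  moreover have "monomial_sum n P w = (0::'k)" for P
  proof -
    have "{f \<in> {1..n} \<rightarrow>\<^sub>E {1..}. P f \<and> map f [1..<Suc n] = w} = {}"
      using assms(2) by auto
    then show ?thesis
      by (simp only: monomial_sum_def card.empty of_nat_0)
  qed
  ultimately have "x w = 0"
    by (simp add: m_series_def)
  with step show ?case
    by (simp add: series_scale_def)
qed

text \<open>By \<open>WSym_degree_support\<close> the sum of the \<open>WSym_degree n\<close> inside the space of all series is
  direct, so \<open>\<Oplus>\<^sub>n WSym_degree n\<close> is the span of their union.\<close>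

definition WSym :: "'k::field_char_0 series set" where
  "WSym = series_vs.span (\<Union>n. WSym_degree n)"

definition Upsilon :: "(graph \<Rightarrow>\<^sub>0 'k::field_char_0) \<Rightarrow> 'k series" where
  "Upsilon x = (\<Sum>G\<in>Poly_Mapping.keys x.
     series_scale (Poly_Mapping.lookup x G) (chromatic_series G))"

lemma Upsilon_basis: "Upsilon (basis G) = chromatic_series G"
  by (simp add: Upsilon_def series_scale_def)

lemma Upsilon_superset:
  assumes "finite A" "Poly_Mapping.keys x \<subseteq> A"
  shows "Upsilon x = (\<Sum>G\<in>A. series_scale (Poly_Mapping.lookup x G) (chromatic_series G))"
  unfolding Upsilon_def using assms
  by (intro sum.mono_neutral_left) (auto simp: in_keys_iff)

lemma linear_Upsilon:
  "Vector_Spaces.linear graph_scale series_scale (Upsilon :: (graph \<Rightarrow>\<^sub>0 'k::field_char_0) \<Rightarrow> _)"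
proof unfold_locales
  fix x y :: "graph \<Rightarrow>\<^sub>0 'k" and c :: 'k
  let ?A = "Poly_Mapping.keys x \<union> Poly_Mapping.keys y"
  have "Poly_Mapping.keys (x + y) \<subseteq> ?A"
    by (rule Poly_Mapping.keys_add)
  then show "Upsilon (x + y) = Upsilon x + Upsilon y"
    by (simp add: Upsilon_superset[of ?A] lookup_add series_vs.scale_left_distrib sum.distrib)
  have "Poly_Mapping.keys (graph_scale c x) \<subseteq> Poly_Mapping.keys x"
    by (auto simp: in_keys_iff lookup_graph_scale)
  then have "Upsilon (graph_scale c x) = (\<Sum>G\<in>Poly_Mapping.keys x.
      series_scale (Poly_Mapping.lookup (graph_scale c x) G) (chromatic_series G))"
    by (simp add: Upsilon_superset[of "Poly_Mapping.keys x"])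
  also have "\<dots> = (\<Sum>G\<in>Poly_Mapping.keys x.
      series_scale c (series_scale (Poly_Mapping.lookup x G) (chromatic_series G)))"
    by (intro sum.cong) (auto simp: lookup_graph_scale)
  finally show "Upsilon (graph_scale c x) = series_scale c (Upsilon x)"
    by (simp add: Upsilon_def series_vs.scale_sum_right)
qed

definition modular_relations :: "(graph \<Rightarrow>\<^sub>0 'k::field_char_0) set" where
  "modular_relations =
     {basis (n, E) - basis (n, E \<union> {{i, j}}) - basis (n, E \<union> {{i, k}})
        + basis (n, E \<union> {{i, j}, {i, k}}) | n E i j k.
      (n, E) \<in> graphs \<and> {i, j, k} \<subseteq> {1..n} \<and> i \<noteq> j \<and> i \<noteq> k \<and> j \<noteq> k \<and>
      {j, k} \<in> E \<and> {i, j} \<notin> E \<and> {i, k} \<notin> E}"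

end

theory Submission
  imports Defs
begin

text \<open>A coloring is proper for \<open>(n, E)\<close> iff \<open>E\<close> is contained in the set of pairs to which it gives
  two different colors. Grouping the colorings by this set \<open>E'\<close>, the chromatic series of \<open>(n, E)\<close>
  is the sum over \<open>E' \<supseteq> E\<close> of series that are either zero or some \<open>m\<^bsub>\<pi>\<^esub>\<close>, and this triangular system
  can be inverted; this settles the image. For the kernel, a graph that is not complete multipartite
  has an edge \<open>jk\<close> and a vertex \<open>i\<close> adjacent to neither \<open>j\<close> nor \<open>k\<close>, so a modular
  relation rewrites it by graphs with more edges. Modulo these relations only complete multipartite
  graphs remain, and their chromatic series are linearly independent: among
  those in a linear relation take one with the fewest edges; coloring it by its parts gives a
  coloring that is proper for no other graph in the relation.\<close>

text \<open>The edge set of the complete multipartite graph on \<open>{1..n}\<close> whose parts are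
  the color classes of \<open>f\<close>. Within \<open>all_edges n\<close> it is the largest edge
  set for which \<open>f\<close> is proper.\<close>

definition bichromatic :: "nat \<Rightarrow> (nat \<Rightarrow> nat) \<Rightarrow> nat set set" where
  "bichromatic n f = {{i, j} | i j. i \<in> {1..n} \<and> j \<in> {1..n} \<and> f i \<noteq> f j}"

definition word_of :: "nat \<Rightarrow> (nat \<Rightarrow> nat) \<Rightarrow> nat list" where
  "word_of n f = map f [1..<Suc n]"

text \<open>Indexed by edge sets rather than by set partitions, so that chromatic series expand as
  sums over all larger edge sets. It vanishes unless \<open>(n, E)\<close> is complete
  multipartite.\<close>

definition color_series :: "nat \<Rightarrow> nat set set \<Rightarrow> 'k::field_char_0 series" where
  "color_series n E = monomial_sum n (\<lambda>f. bichromatic n f = E)"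

text \<open>Each complete multipartite graph is presented by a coloring that has its parts as color
  classes; the word of this coloring later serves as a test monomial.\<close>

definition multipartite_graphs :: "graph set" where
  "multipartite_graphs = {(n, bichromatic n f) | n f. f \<in> {1..n} \<rightarrow>\<^sub>E {1..}}"

section \<open>Pairs of vertices and proper colorings\<close>

lemma bichromatic_subset: "bichromatic n f \<subseteq> all_edges n"
  unfolding bichromatic_def all_edges_def by blast

lemma pair_in_bichromatic_iff:
  assumes "i \<in> {1..n}" "j \<in> {1..n}"
  shows "{i, j} \<in> bichromatic n f \<longleftrightarrow> f i \<noteq> f j"
  using assms unfolding bichromatic_def by (auto simp: doubleton_eq_iff)

lemma pair_in_all_edges_iff: "{i, j} \<in> all_edges n \<longleftrightarrow> i \<in> {1..n} \<and> j \<in> {1..n} \<and> i \<noteq> j"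
  unfolding all_edges_def by (auto simp: doubleton_eq_iff)

lemma all_edges_cases:
  assumes "e \<in> all_edges n"
  obtains i j where "e = {i, j}" "i \<in> {1..n}" "j \<in> {1..n}" "i \<noteq> j"
  using assms unfolding all_edges_def by blast

lemma finite_all_edges: "finite (all_edges n)"
  by (rule finite_subset[of _ "Pow {1..n}"]) (auto simp: all_edges_def)

lemma all_edges_subset_eqI:
  assumes "A \<subseteq> all_edges n" "B \<subseteq> all_edges n"
    and "\<And>i j. i \<in> {1..n} \<Longrightarrow> j \<in> {1..n} \<Longrightarrow> i \<noteq> j \<Longrightarrow> {i, j} \<in> A \<longleftrightarrow> {i, j} \<in> B"
  shows "A = B"
  using assms by (blast elim: all_edges_cases)

lemma proper_coloring_iff:
  assumes "E \<subseteq> all_edges n"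
  shows "proper_coloring (n, E) f \<longleftrightarrow> E \<subseteq> bichromatic n f"
proof
  assume P: "proper_coloring (n, E) f"
  show "E \<subseteq> bichromatic n f"
  proof
    fix e assume "e \<in> E"
    moreover from this assms obtain i j where "e = {i, j}" "i \<in> {1..n}" "j \<in> {1..n}"
      by (blast elim: all_edges_cases)
    ultimately show "e \<in> bichromatic n f"
      using P pair_in_bichromatic_iff by (auto simp: proper_coloring_def)
  qed
next
  assume sub: "E \<subseteq> bichromatic n f"
  show "proper_coloring (n, E) f"
    unfolding proper_coloring_def snd_conv
  proof (intro allI impI)
    fix i j assume ij: "{i, j} \<in> E"
    with assms have "i \<in> {1..n}" "j \<in> {1..n}"
      using pair_in_all_edges_iff by blast+
    with ij sub show "f i \<noteq> f j"
      using pair_in_bichromatic_iff by blast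
  qed
qed

section \<open>Coefficients of monomial sums\<close>

lemma word_of_inj:
  assumes "f \<in> {1..n} \<rightarrow>\<^sub>E A" "g \<in> {1..n} \<rightarrow>\<^sub>E A" "word_of n f = word_of n g"
  shows "f = g"
  using assms(3) by (intro PiE_ext[OF assms(1,2)]) (auto simp: word_of_def simp del: upt_Suc)

text \<open>Only \<open>f\<close> itself spells \<open>word_of n f\<close>, so the counted set is
  \<open>{f}\<close> or empty. Together with the vanishing on all other words, this reduces
  identities between series to a check at the words of colorings.\<close>

lemma monomial_sum_word_of:
  assumes "f \<in> {1..n} \<rightarrow>\<^sub>E {1..}"
  shows "monomial_sum n P (word_of n f) = (of_bool (P f) :: 'k::field_char_0)"
proof -
  have "{g \<in> {1..n} \<rightarrow>\<^sub>E {1..}. P g \<and> map g [1..<Suc n] = word_of n f} = (if P f then {f} else {})"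
    using assms word_of_inj[OF _ assms] unfolding word_of_def[symmetric] by auto
  then show ?thesis
    unfolding monomial_sum_def by simp
qed

lemma monomial_sum_not_word:
  assumes "\<And>f. f \<in> {1..n} \<rightarrow>\<^sub>E {1..} \<Longrightarrow> w \<noteq> word_of n f"
  shows "monomial_sum n P w = (0 :: 'k::field_char_0)"
proof -
  have "{f \<in> {1..n} \<rightarrow>\<^sub>E {1..}. P f \<and> map f [1..<Suc n] = w} = {}"
    using assms unfolding word_of_def[symmetric] by blast
  then show ?thesis
    unfolding monomial_sum_def by (simp only: card.empty of_nat_0)
qed

lemma monomial_sum_cong:
  assumes "\<And>f. f \<in> {1..n} \<rightarrow>\<^sub>E {1..} \<Longrightarrow> P f \<longleftrightarrow> Q f"
  shows "monomial_sum n P = (monomial_sum n Q :: 'k::field_char_0 series)"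
proof -
  have "{f \<in> {1..n} \<rightarrow>\<^sub>E {1..}. P f \<and> map f [1..<Suc n] = w}
      = {f \<in> {1..n} \<rightarrow>\<^sub>E {1..}. Q f \<and> map f [1..<Suc n] = w}" for w
    using assms by blast
  then show ?thesis
    unfolding monomial_sum_def by simp
qed

lemma chromatic_series_word_of:
  assumes "E \<subseteq> all_edges n" "f \<in> {1..n} \<rightarrow>\<^sub>E {1..}"
  shows "chromatic_series (n, E) (word_of n f) = (of_bool (E \<subseteq> bichromatic n f) :: 'k::field_char_0)"
  using assms by (simp add: chromatic_series_def monomial_sum_word_of proper_coloring_iff)

lemma chromatic_series_not_word:
  assumes "\<And>f. f \<in> {1..n} \<rightarrow>\<^sub>E {1..} \<Longrightarrow> w \<noteq> word_of n f"
  shows "chromatic_series (n, E) w = (0 :: 'k::field_char_0)"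
  using monomial_sum_not_word[OF assms] by (simp add: chromatic_series_def)

subsection \<open>The image\<close>

lemma sum_series_apply:
  fixes F :: "'i \<Rightarrow> 'k::field_char_0 series"
  shows "(\<Sum>i\<in>A. F i) w = (\<Sum>i\<in>A. F i w)"
  by (induction A rule: infinite_finite_induct) auto

text \<open>Every coloring \<open>f\<close> belongs to exactly one index,
  \<open>E' = bichromatic n f\<close>, and this index lies in the range of summation iff
  \<open>f\<close> is proper.\<close>

lemma chromatic_series_eq_sum:
  assumes "E \<subseteq> all_edges n"
  shows "chromatic_series (n, E) =
    (\<Sum>E' | E \<subseteq> E' \<and> E' \<subseteq> all_edges n. color_series n E' :: 'k::field_char_0 series)"
proof
  fix w
  have fin: "finite {E'. E \<subseteq> E' \<and> E' \<subseteq> all_edges n}"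
    by (rule finite_subset[of _ "Pow (all_edges n)"]) (auto simp: finite_all_edges)
  show "chromatic_series (n, E) w =
    (\<Sum>E' | E \<subseteq> E' \<and> E' \<subseteq> all_edges n. color_series n E' :: 'k series) w"
  proof (cases "\<exists>f \<in> {1..n} \<rightarrow>\<^sub>E {1..}. w = word_of n f")
    case True
    then obtain f where f: "f \<in> {1..n} \<rightarrow>\<^sub>E {1..}" "w = word_of n f"
      by blast
    have "(\<Sum>E' | E \<subseteq> E' \<and> E' \<subseteq> all_edges n. color_series n E' w) =
        (\<Sum>E' | E \<subseteq> E' \<and> E' \<subseteq> all_edges n. if bichromatic n f = E' then 1 else (0::'k))"
      using f by (intro sum.cong) (auto simp: color_series_def monomial_sum_word_of)
    also have "\<dots> = of_bool (E \<subseteq> bichromatic n f)"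
      using fin bichromatic_subset[of n f] by (subst sum.delta') auto
    finally show ?thesis
      using f assms by (simp add: chromatic_series_word_of sum_series_apply)
  next
    case False
    then have "color_series n E' w = (0::'k)" for E'
      unfolding color_series_def by (intro monomial_sum_not_word) blast
    moreover have "chromatic_series (n, E) w = (0::'k)"
      using False by (intro chromatic_series_not_word) blast
    ultimately show ?thesis
      by (simp add: sum_series_apply)
  qed
qed

text \<open>Inversion of the triangular system by induction on the number of missing edges: the
  diagonal term \<open>E' = E\<close> is solved for, and all other terms belong to strictly larger
  edge sets.\<close>

lemma color_series_in_span_chromatic:
  assumes "E \<subseteq> all_edges n"
  shows "(color_series n E :: 'k::field_char_0 series)
    \<in> series_vs.span (chromatic_series ` graphs)"
  using assms
proof (induction "card (all_edges n - E)" arbitrary: E rule: less_induct)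
  case less
  let ?S = "{E'. E \<subseteq> E' \<and> E' \<subseteq> all_edges n}"
  have fin: "finite ?S"
    by (rule finite_subset[of _ "Pow (all_edges n)"]) (auto simp: finite_all_edges)
  have "chromatic_series (n, E) =
      color_series n E + (\<Sum>E'\<in>?S - {E}. color_series n E' :: 'k series)"
    unfolding chromatic_series_eq_sum[OF less.prems]
    using less.prems by (intro sum.remove[OF fin]) auto
  then have eq: "color_series n E =
      chromatic_series (n, E) - (\<Sum>E'\<in>?S - {E}. color_series n E' :: 'k series)"
    by (simp add: algebra_simps)
  have "(color_series n E' :: 'k series) \<in> series_vs.span (chromatic_series ` graphs)"
    if "E' \<in> ?S - {E}" for E'
  proof (rule less.hyps)
    show "card (all_edges n - E') < card (all_edges n - E)"
      using that less.prems by (intro psubset_card_mono) (auto simp: finite_all_edges)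
  qed (use that in auto)
  then have "(\<Sum>E'\<in>?S - {E}. color_series n E' :: 'k series)
      \<in> series_vs.span (chromatic_series ` graphs)"
    by (rule series_vs.span_sum)
  moreover have "(chromatic_series (n, E) :: 'k series) \<in> series_vs.span (chromatic_series ` graphs)"
    using less.prems by (intro series_vs.span_base imageI) (simp add: graphs_def)
  ultimately show ?case
    unfolding eq by (intro series_vs.span_diff)
qed

section \<open>Set partitions and edge sets\<close>

lemma m_series_eq_color_series:
  assumes "partition_on {1..n} \<pi>"
  shows "m_series n \<pi> =
    (color_series n {e \<in> all_edges n. \<forall>B\<in>\<pi>. \<not> e \<subseteq> B} :: 'k::field_char_0 series)"
  unfolding m_series_def color_series_def
proof (rule monomial_sum_cong)
  fix f
  let ?E = "{e \<in> all_edges n. \<forall>B\<in>\<pi>. \<not> e \<subseteq> B}"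
  \<comment> \<open>This serves the diagonal case \<open>i = j\<close>: the singleton
    \<open>{i, i}\<close> is never an edge, so the edge sets say nothing there, and the condition on
    \<open>f\<close> reduces to \<open>i\<close> lying in some block.\<close>
  have refl: "\<exists>B\<in>\<pi>. i \<in> B" if "i \<in> {1..n}" for i
    using that assms by (auto simp: partition_on_def)
  show "(\<forall>i\<in>{1..n}. \<forall>j\<in>{1..n}. f i = f j \<longleftrightarrow> (\<exists>B\<in>\<pi>. i \<in> B \<and> j \<in> B))
      \<longleftrightarrow> bichromatic n f = ?E"
  proof
    assume L: "\<forall>i\<in>{1..n}. \<forall>j\<in>{1..n}. f i = f j \<longleftrightarrow> (\<exists>B\<in>\<pi>. i \<in> B \<and> j \<in> B)"
    show "bichromatic n f = ?E"
    proof (rule all_edges_subset_eqI)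
      fix i j assume ij: "i \<in> {1..n}" "j \<in> {1..n}" "i \<noteq> j"
      then show "{i, j} \<in> bichromatic n f \<longleftrightarrow> {i, j} \<in> ?E"
        using L by (simp add: pair_in_bichromatic_iff pair_in_all_edges_iff)
    qed (auto simp: bichromatic_subset)
  next
    assume R: "bichromatic n f = ?E"
    show "\<forall>i\<in>{1..n}. \<forall>j\<in>{1..n}. f i = f j \<longleftrightarrow> (\<exists>B\<in>\<pi>. i \<in> B \<and> j \<in> B)"
    proof (intro ballI)
      fix i j assume ij: "i \<in> {1..n}" "j \<in> {1..n}"
      have "f i \<noteq> f j \<longleftrightarrow> {i, j} \<in> ?E"
        by (simp only: R[symmetric] pair_in_bichromatic_iff[OF ij])
      then show "f i = f j \<longleftrightarrow> (\<exists>B\<in>\<pi>. i \<in> B \<and> j \<in> B)"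
        using ij refl by (cases "i = j") (auto simp: pair_in_all_edges_iff)
    qed
  qed
qed

lemma color_series_bichromatic:
  obtains \<pi> where "partition_on {1..n} \<pi>"
    "(color_series n (bichromatic n f) :: 'k::field_char_0 series) = m_series n \<pi>"
proof
  \<comment> \<open>The blocks are the color classes of \<open>f\<close>; a pair lies in no common
    block exactly when its colors differ.\<close>
  let ?\<pi> = "(\<lambda>i. {j \<in> {1..n}. f j = f i}) ` {1..n}"
  show part: "partition_on {1..n} ?\<pi>"
    by (rule partition_onI) (auto simp: disjnt_def)
  have "{e \<in> all_edges n. \<forall>B\<in>?\<pi>. \<not> e \<subseteq> B} = bichromatic n f"
  proof (rule all_edges_subset_eqI)
    fix i j assume ij: "i \<in> {1..n}" "j \<in> {1..n}" "i \<noteq> j"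
    have "(\<forall>B\<in>?\<pi>. \<not> {i, j} \<subseteq> B) \<longleftrightarrow> f i \<noteq> f j"
      using ij by auto
    then show "{i, j} \<in> {e \<in> all_edges n. \<forall>B\<in>?\<pi>. \<not> e \<subseteq> B} \<longleftrightarrow> {i, j} \<in> bichromatic n f"
      using ij by (simp only: mem_Collect_eq pair_in_bichromatic_iff pair_in_all_edges_iff simp_thms)
  qed (auto simp: bichromatic_subset)
  then show "(color_series n (bichromatic n f) :: 'k series) = m_series n ?\<pi>"
    by (simp only: m_series_eq_color_series[OF part])
qed

lemma color_series_in_span_m:
  "(color_series n E :: 'k::field_char_0 series) \<in>
     series_vs.span {m_series n \<pi> | n \<pi>. partition_on {1..n} \<pi>}"
proof (cases "\<exists>f \<in> {1..n} \<rightarrow>\<^sub>E {1..}. bichromatic n f = E")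
  case True
  then obtain f where "bichromatic n f = E"
    by blast
  then obtain \<pi> where "partition_on {1..n} \<pi>" "(color_series n E :: 'k series) = m_series n \<pi>"
    using color_series_bichromatic by metis
  then show ?thesis
    by (intro series_vs.span_base) blast
next
  case False
  \<comment> \<open>With no coloring separating exactly the pairs in \<open>E\<close>, every
    coefficient is zero.\<close>
  have "color_series n E w = (0::'k)" for w
  proof (cases "\<exists>f \<in> {1..n} \<rightarrow>\<^sub>E {1..}. w = word_of n f")
    case True
    with False show ?thesis
      by (auto simp: color_series_def monomial_sum_word_of)
  next
    case False
    then show ?thesis
      unfolding color_series_def by (intro monomial_sum_not_word) blast
  qed
  then have "color_series n E = (0 :: 'k series)"
    by (simp add: fun_eq_iff)
  then show ?thesis
    by (simp add: series_vs.span_zero)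
qed

section \<open>Spans and the image of \<open>Upsilon\<close>\<close>

lemma WSym_eq_span:
  "(WSym :: 'k::field_char_0 series set) =
     series_vs.span {m_series n \<pi> | n \<pi>. partition_on {1..n} \<pi>}" (is "_ = series_vs.span ?M")
proof -
  have "WSym_degree n \<subseteq> series_vs.span ?M" for n
    unfolding WSym_degree_def by (rule series_vs.span_mono) blast
  moreover have "?M \<subseteq> (\<Union>n. WSym_degree n)"
    unfolding WSym_degree_def by (blast intro: series_vs.span_base)
  ultimately show ?thesis
    unfolding WSym_def series_vs.span_eq by (blast intro: series_vs.span_base)
qed

lemma span_chromatic_series:
  "series_vs.span (chromatic_series ` graphs) = (WSym :: 'k::field_char_0 series set)"
proof -
  have "chromatic_series G \<in> series_vs.span {m_series n \<pi> :: 'k series | n \<pi>. partition_on {1..n} \<pi>}"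
    if "G \<in> graphs" for G
    using that by (auto simp: graphs_def chromatic_series_eq_sum simp del: One_nat_def
        intro!: series_vs.span_sum color_series_in_span_m)
  moreover have "(m_series n \<pi> :: 'k series) \<in> series_vs.span (chromatic_series ` graphs)"
    if "partition_on {1..n} \<pi>" for n \<pi>
    unfolding m_series_eq_color_series[OF that]
    by (rule color_series_in_span_chromatic) blast
  ultimately show ?thesis
    unfolding WSym_eq_span series_vs.span_eq by blast
qed

text \<open>Turns the support condition defining \<open>graph_space\<close> into a span, so that
  facts about linear maps on spans apply to it.\<close>

lemma span_basis:
  "graph_vs.span (basis ` A) = {x :: graph \<Rightarrow>\<^sub>0 'k::field_char_0. Poly_Mapping.keys x \<subseteq> A}"
proof (intro equalityI subsetI)
  fix x :: "graph \<Rightarrow>\<^sub>0 'k"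
  assume "x \<in> graph_vs.span (basis ` A)"
  then have "Poly_Mapping.keys x \<subseteq> A"
  proof (induction rule: graph_vs.span_induct_alt)
    case (step c x y)
    from step(1) have "Poly_Mapping.keys (graph_scale c x) \<subseteq> A"
      by (auto simp: in_keys_iff lookup_graph_scale lookup_single when_def split: if_splits)
    with step(2) Poly_Mapping.keys_add[of "graph_scale c x" y] show ?case
      by blast
  qed simp
  then show "x \<in> {x. Poly_Mapping.keys x \<subseteq> A}"
    by simp
next
  fix x :: "graph \<Rightarrow>\<^sub>0 'k"
  assume A: "x \<in> {x. Poly_Mapping.keys x \<subseteq> A}"
  have "x = (\<Sum>G\<in>Poly_Mapping.keys x. graph_scale (Poly_Mapping.lookup x G) (basis G))"
    by (rule poly_mapping_eqI)
      (simp add: lookup_sum lookup_graph_scale lookup_single when_def in_keys_iff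
        if_distrib[of "(*) _"] cong: if_cong)
  also have "\<dots> \<in> graph_vs.span (basis ` A)"
    using A by (intro graph_vs.span_sum graph_vs.span_scale graph_vs.span_base) auto
  finally show "x \<in> graph_vs.span (basis ` A)" .
qed

interpretation Upsilon: Vector_Spaces.linear graph_scale series_scale
  "Upsilon :: (graph \<Rightarrow>\<^sub>0 'k::field_char_0) \<Rightarrow> _"
  by (rule linear_Upsilon)

lemma image_Upsilon: "Upsilon ` graph_space = (WSym :: 'k::field_char_0 series set)"
proof -
  have "Upsilon ` graph_space = series_vs.span (Upsilon ` basis ` graphs :: 'k series set)"
    unfolding graph_space_def span_basis[symmetric] by (rule Upsilon.span_image[symmetric])
  then show ?thesis
    by (simp add: image_image Upsilon_basis span_chromatic_series)
qed

subsection \<open>The kernel\<close>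

text \<open>At the word of a coloring proper for \<open>E\<close>, the four coefficients add up to
  \<open>1 - a - b + a * b = (1 - a) * (1 - b)\<close>, where \<open>a\<close> and \<open>b\<close>
  indicate \<open>f i \<noteq> f j\<close> and \<open>f i \<noteq> f k\<close>. Since
  \<open>jk\<close> is an edge, \<open>f i\<close> cannot equal both \<open>f j\<close> and
  \<open>f k\<close>, so one factor vanishes. At all other words each coefficient is zero.\<close>

lemma modular_relation_in_kernel:
  assumes "r \<in> modular_relations"
  shows "r \<in> graph_space" "Upsilon r = (0 :: 'k::field_char_0 series)"
proof -
  from assms obtain n E i j k where r: "r = basis (n, E) - basis (n, E \<union> {{i, j}})
      - basis (n, E \<union> {{i, k}}) + basis (n, E \<union> {{i, j}, {i, k}})"
    and E: "E \<subseteq> all_edges n" and v: "i \<in> {1..n}" "j \<in> {1..n}" "k \<in> {1..n}"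
    and ne: "i \<noteq> j" "i \<noteq> k" and jk: "{j, k} \<in> E"
    unfolding modular_relations_def graphs_def by blast
  have G: "E \<union> {{i, j}} \<subseteq> all_edges n" "E \<union> {{i, k}} \<subseteq> all_edges n"
    "E \<union> {{i, j}, {i, k}} \<subseteq> all_edges n"
    using E v ne by (auto simp: pair_in_all_edges_iff simp del: atLeastAtMost_iff)
  show "r \<in> graph_space"
    unfolding graph_space_def span_basis[symmetric] r
    using E G by (intro graph_vs.span_add graph_vs.span_diff graph_vs.span_base)
      (auto simp: graphs_def)
  have "Upsilon r = chromatic_series (n, E) - chromatic_series (n, E \<union> {{i, j}})
      - chromatic_series (n, E \<union> {{i, k}}) + chromatic_series (n, E \<union> {{i, j}, {i, k}})"
    by (simp only: r Upsilon.add Upsilon.diff Upsilon_basis)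
  moreover have "\<dots> w = (0::'k)" for w
  proof (cases "\<exists>f \<in> {1..n} \<rightarrow>\<^sub>E {1..}. w = word_of n f")
    case True
    then obtain f where f: "f \<in> {1..n} \<rightarrow>\<^sub>E {1..}" "w = word_of n f"
      by blast
    have "E \<subseteq> bichromatic n f \<Longrightarrow> f j \<noteq> f k"
      using jk v pair_in_bichromatic_iff by blast
    then show ?thesis
      unfolding plus_fun_apply fun_diff_def f(2) chromatic_series_word_of[OF E f(1)]
        G[THEN chromatic_series_word_of, OF f(1)]
      using v by (auto simp: pair_in_bichromatic_iff simp del: atLeastAtMost_iff)
  next
    case False
    then have "chromatic_series (n, E') w = (0::'k)" for E'
      by (intro chromatic_series_not_word) blast
    then show ?thesis
      by simp
  qed
  ultimately show "Upsilon r = (0 :: 'k series)"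
    by (simp add: fun_eq_iff)
qed

section \<open>Reduction to complete multipartite graphs\<close>

lemma multipartiteI:
  assumes E: "E \<subseteq> all_edges n"
    and dom: "\<And>i j k. i \<in> {1..n} \<Longrightarrow> {j, k} \<in> E \<Longrightarrow> i \<noteq> j \<Longrightarrow> i \<noteq> k \<Longrightarrow> {i, j} \<in> E \<or> {i, k} \<in> E"
  shows "(n, E) \<in> multipartite_graphs"
proof -
  \<comment> \<open>The hypothesis \<open>dom\<close> makes non-adjacency an equivalence relation on
    \<open>{1..n}\<close>, and \<open>N i\<close> is the class of \<open>i\<close>. Its least
    element names the class by a vertex, which is in particular a positive color.\<close>
  define N where "N i = {j \<in> {1..n}. {i, j} \<notin> E}" for i
  define f where "f = restrict (\<lambda>i. Min (N i)) {1..n}"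
  have loop: "{i, i} \<notin> E" for i
    using E pair_in_all_edges_iff[of i i n] by blast
  have fin: "finite (N i)" for i
    by (simp add: N_def)
  have self: "i \<in> N i" if "i \<in> {1..n}" for i
    using that loop[of i] by (simp add: N_def)
  have MinN: "Min (N i) \<in> N i" if "i \<in> {1..n}" for i
    using self[OF that] fin by (intro Min_in) auto
  \<comment> \<open>The contrapositive of \<open>dom\<close> at the middle vertex \<open>j\<close>:
    an edge \<open>ik\<close> would force \<open>j\<close> to be adjacent to \<open>i\<close> or to
    \<open>k\<close>.\<close>
  have trans: "{i, k} \<notin> E" if "{i, j} \<notin> E" "{j, k} \<notin> E" "j \<in> {1..n}" for i j k
    using dom[of j i k] that loop by (metis insert_commute)
  have same: "f i = f j \<longleftrightarrow> {i, j} \<notin> E" if ij: "i \<in> {1..n}" "j \<in> {1..n}" for i j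
  proof
    assume "f i = f j"
    then have "Min (N i) = Min (N j)"
      using ij by (simp add: f_def)
    \<comment> \<open>The common minimum is adjacent to neither \<open>i\<close> nor
      \<open>j\<close>, hence a middle vertex for transitivity.\<close>
    then have "Min (N i) \<in> N i" "Min (N i) \<in> N j"
      using MinN ij by metis+
    then show "{i, j} \<notin> E"
      using trans[of i "Min (N i)" j] by (simp add: N_def insert_commute)
  next
    assume "{i, j} \<notin> E"
    then have "N i = N j"
      using trans[of i j] trans[of j i] ij unfolding N_def by (auto simp: insert_commute)
    then show "f i = f j"
      using ij by (simp add: f_def)
  qed
  have "f \<in> {1..n} \<rightarrow>\<^sub>E {1..}"
    using MinN by (auto simp: f_def N_def)
  moreover have "E = bichromatic n f"
    using same by (intro all_edges_subset_eqI[OF E bichromatic_subset])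
      (simp add: pair_in_bichromatic_iff)
  ultimately show ?thesis
    unfolding multipartite_graphs_def by blast
qed

text \<open>Induction on the number of missing edges; the failure of the criterion
  \<open>multipartiteI\<close> supplies the triangle of a modular relation whose other three graphs
  are strictly larger.\<close>

lemma basis_in_span_multipartite:
  assumes "E \<subseteq> all_edges n"
  shows "(basis (n, E) :: graph \<Rightarrow>\<^sub>0 'k::field_char_0)
    \<in> graph_vs.span (modular_relations \<union> basis ` multipartite_graphs)" (is "_ \<in> ?S")
  using assms
proof (induction "card (all_edges n - E)" arbitrary: E rule: less_induct)
  case less
  show ?case
  proof (cases "(n, E) \<in> multipartite_graphs")
    case True
    then show ?thesis
      by (intro graph_vs.span_base) auto
  next
    case False
    then obtain i j k where i: "i \<in> {1..n}" and jk: "{j, k} \<in> E"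
      and ne: "i \<noteq> j" "i \<noteq> k" and non: "{i, j} \<notin> E" "{i, k} \<notin> E"
      using multipartiteI[OF less.prems] by blast
    have v: "j \<in> {1..n}" "k \<in> {1..n}" "j \<noteq> k"
      using jk less.prems pair_in_all_edges_iff by blast+
    have smaller: "basis (n, E') \<in> ?S"
      if "E \<subset> E'" "E' \<subseteq> all_edges n" for E'
    proof (rule less.hyps)
      show "card (all_edges n - E') < card (all_edges n - E)"
        using that by (intro psubset_card_mono) (auto simp: finite_all_edges)
    qed (fact that)
    have edges: "{i, j} \<in> all_edges n" "{i, k} \<in> all_edges n"
      using i v ne by (simp_all add: pair_in_all_edges_iff)
    let ?r = "basis (n, E) - basis (n, E \<union> {{i, j}}) - basis (n, E \<union> {{i, k}})
        + basis (n, E \<union> {{i, j}, {i, k}}) :: graph \<Rightarrow>\<^sub>0 'k"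
    have "?r \<in> modular_relations"
      unfolding modular_relations_def graphs_def using i v ne jk non less.prems by blast
    then have "?r \<in> ?S"
      by (intro graph_vs.span_base) blast
    moreover have "basis (n, E \<union> {{i, j}}) \<in> ?S" "basis (n, E \<union> {{i, k}}) \<in> ?S"
      "basis (n, E \<union> {{i, j}, {i, k}}) \<in> ?S"
      using edges less.prems non by (intro smaller; blast)+
    \<comment> \<open>Cancelling the three larger graphs from the relation leaves
      \<open>basis (n, E)\<close>.\<close>
    ultimately have "?r + basis (n, E \<union> {{i, j}}) + basis (n, E \<union> {{i, k}})
        - basis (n, E \<union> {{i, j}, {i, k}}) \<in> ?S"
      by (rule graph_vs.span_diff[OF graph_vs.span_add[OF graph_vs.span_add]])
    moreover have "a - b - c + d + b + c - d = a" for a b c d :: "graph \<Rightarrow>\<^sub>0 'k"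
      by simp
    ultimately show ?thesis
      by (simp only:)
  qed
qed

section \<open>Independence of the chromatic series of complete multipartite graphs\<close>

lemma Upsilon_apply:
  "Upsilon x w = (\<Sum>G\<in>Poly_Mapping.keys x. Poly_Mapping.lookup x G * chromatic_series G w)"
  by (simp add: Upsilon_def sum_series_apply series_scale_def)

lemma Upsilon_inj_multipartite:
  assumes keys: "Poly_Mapping.keys x \<subseteq> multipartite_graphs"
    and zero: "Upsilon x = (0 :: 'k::field_char_0 series)"
  shows "x = 0"
proof (rule ccontr)
  assume "x \<noteq> 0"
  then obtain G\<^sub>0 where "G\<^sub>0 \<in> Poly_Mapping.keys x"
    by (metis all_not_in_conv keys_eq_empty)
  \<comment> \<open>Edges are minimized over the whole support, across all numbers of vertices.
    Graphs on another number of vertices drop out below because their words have another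
    length.\<close>
  then obtain G where G: "G \<in> Poly_Mapping.keys x"
    and least: "\<And>H. H \<in> Poly_Mapping.keys x \<Longrightarrow> card (snd G) \<le> card (snd H)"
    using ex_has_least_nat[of "\<lambda>H. H \<in> Poly_Mapping.keys x" G\<^sub>0 "\<lambda>H. card (snd H)"]
    by blast
  from G keys obtain n f where f: "f \<in> {1..n} \<rightarrow>\<^sub>E {1..}" and Gf: "G = (n, bichromatic n f)"
    unfolding multipartite_graphs_def by blast
  have other: "chromatic_series H (word_of n f) = (0::'k)"
    if H: "H \<in> Poly_Mapping.keys x" "H \<noteq> G" for H
  proof -
    from H keys obtain m g where "H = (m, bichromatic m g)"
      unfolding multipartite_graphs_def by blast
    then obtain E where mE: "H = (m, E)" "E \<subseteq> all_edges m"
      by (simp add: bichromatic_subset)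
    show ?thesis
    proof (cases "m = n")
      case False
      have "word_of n f \<noteq> word_of m g" for g
      proof
        assume "word_of n f = word_of m g"
        then have "length (word_of n f) = length (word_of m g)"
          by simp
        with False show False
          by (simp add: word_of_def del: upt_Suc)
      qed
      then show ?thesis
        unfolding mE by (intro chromatic_series_not_word) simp
    next
      case True
      \<comment> \<open>If \<open>f\<close> were proper for \<open>H\<close>, then \<open>E\<close>
        would be contained in the edge set of \<open>G\<close> without having fewer edges, so
        \<open>H\<close> would equal \<open>G\<close>.\<close>
      have "\<not> E \<subseteq> bichromatic n f"
      proof
        assume "E \<subseteq> bichromatic n f"
        moreover have "finite (bichromatic n f)"
          using finite_subset[OF bichromatic_subset finite_all_edges] .
        moreover have "card (bichromatic n f) \<le> card E"
          using least[OF H(1)] Gf mE by simp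
        ultimately have "E = bichromatic n f"
          by (simp add: card_seteq)
        with H(2) True mE Gf show False
          by simp
      qed
      then show ?thesis
        using mE True f by (simp add: chromatic_series_word_of)
    qed
  qed
  have "Upsilon x (word_of n f) =
      Poly_Mapping.lookup x G * chromatic_series G (word_of n f) +
      (\<Sum>H\<in>Poly_Mapping.keys x - {G}. Poly_Mapping.lookup x H * chromatic_series H (word_of n f))"
    unfolding Upsilon_apply by (rule sum.remove[OF finite_keys G])
  also have "\<dots> = Poly_Mapping.lookup x G"
    using other f by (simp add: Gf chromatic_series_word_of bichromatic_subset)
  finally show False
    using zero G by (simp add: in_keys_iff)
qed

theorem theorem1:
  shows "{x \<in> graph_space. Upsilon x = (0 :: 'k::field_char_0 series)}
           = graph_vs.span modular_relations \<and>
         Upsilon ` graph_space = (WSym :: 'k series set)"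
proof (intro conjI equalityI subsetI)
  fix x :: "graph \<Rightarrow>\<^sub>0 'k"
  assume x: "x \<in> {x \<in> graph_space. Upsilon x = (0 :: 'k series)}"
  then have "x \<in> graph_vs.span (basis ` graphs)"
    by (simp add: span_basis graph_space_def)
  moreover have "basis ` graphs \<subseteq>
      graph_vs.span (modular_relations \<union> basis ` multipartite_graphs :: (graph \<Rightarrow>\<^sub>0 'k) set)"
    using basis_in_span_multipartite by (auto simp: graphs_def)
  ultimately have "x \<in> graph_vs.span (modular_relations \<union> basis ` multipartite_graphs)"
    using graph_vs.span_minimal graph_vs.subspace_span by blast
  \<comment> \<open>\<open>Upsilon\<close> kills \<open>x\<close> and \<open>r\<close>, hence also
    the multipartite part \<open>s\<close>, and injectivity there leaves
    \<open>x = r\<close>.\<close>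
  then obtain r s where xrs: "x = r + s" and r: "r \<in> graph_vs.span modular_relations"
    and s: "s \<in> graph_vs.span (basis ` multipartite_graphs)"
    unfolding graph_vs.span_Un by blast
  have "Upsilon r = (0 :: 'k series)"
    using modular_relation_in_kernel(2) r by (rule Upsilon.eq_0_on_span)
  then have "Upsilon s = (0 :: 'k series)"
    using x xrs by (simp add: Upsilon.add)
  with s have "s = 0"
    by (intro Upsilon_inj_multipartite) (simp_all add: span_basis)
  with xrs r show "x \<in> graph_vs.span modular_relations"
    by simp
next
  fix x :: "graph \<Rightarrow>\<^sub>0 'k"
  assume x: "x \<in> graph_vs.span modular_relations"
  have "Upsilon x = (0 :: 'k series)"
    using modular_relation_in_kernel(2) x by (rule Upsilon.eq_0_on_span)
  \<comment> \<open>\<open>graph_space\<close> is itself a span, so it contains the span of the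
    relations as soon as it contains each relation.\<close>
  moreover have "graph_vs.span modular_relations \<subseteq> (graph_space :: (graph \<Rightarrow>\<^sub>0 'k) set)"
    using modular_relation_in_kernel(1)
    unfolding graph_space_def span_basis[symmetric]
    by (intro graph_vs.span_minimal graph_vs.subspace_span) blast
  ultimately show "x \<in> {x \<in> graph_space. Upsilon x = (0 :: 'k series)}"
    using x by blast
qed (simp_all add: image_Upsilon)

end
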